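(* Let $\mathcal{X}$ be a roux scheme on vertex set $\Omega$ with thin radical $G$. Suppose that for some vertex $x$ and some thick relation $S$ of $\mathcal{X}$, the restrictions of the relations of $\mathcal{X}$ to $S(x)$ form a local association scheme $\mathcal{Y}$ with $|G|$ classes. Then $\mathcal{X}=\mathcal{Y}\widehat\otimes G$; that is, the non-diagonal relations of $\mathcal{Y}$ can be labelled $R_g$ ($g\in G$) with $R_g^\top=R_{g^{-1}}$ such that $\mathcal{X}$ is isomorphic to the scheme on $(S(x)\cup\{\infty\})\times G$ whose adjacency matrices are \[ \mathsf{T}_k=\mathsf{I}\otimes\mathsf{P}_k,\qquad \mathsf{S}_k=\sum_{\ell\in G}\widetilde{\mathsf{A}}_\ell\otimes\mathsf{P}_{k\ell}\qquad(k\in G). \]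
   Context: Association schemes are commutative (partition of $\Omega\times\Omega$ into relations including the identity, closed under transpose, with intersection numbers $p_{ij}^k=p_{ji}^k$). Thin relations have valency $1$ and form a group (the thin radical) under product of adjacency matrices; the others are thick. A roux scheme is obtained from a roux matrix $\mathsf{B}$ (square matrix over $\mathbb{C}[G]$, $G$ abelian, zero diagonal, off-diagonal entries in $G$, $\mathsf{B}_{ji}=\mathsf{B}_{ij}^{-1}$, with $\{g\mathsf{I}\}\cup\{g\mathsf{B}\}$ spanning an algebra) by applying the regular permutation representation of $G$ entrywise to $g\mathsf{I},g\mathsf{B}$ ($g\in G$); up to isomorphism these are the commutative schemes whose thin radical acts regularly by multiplication on thick adjacency matrices and which have a symmetric thick relation. For a relation $S$ and vertex $x$, $S(x)=\{y:(x,y)\in S\}$; the local scheme on $S(x)$ has as relations the nonempty restrictions $R\cap(S(x)\times S(x))$. For $k\in G$, $\mathsf{P}_k$ is the $G\times G$ permutation matrix with $(\mathsf{P}_k)_{g,h}=\delta_{gk,h}$. With $\mathsf{A}_g$ the adjacency matrix of $R_g$ on $S(x)$, the first row and column indexed by the extra point $\infty$, and $\mathbf{1}$ the all-ones row vector: $\widetilde{\mathsf{A}}_1=\begin{bmatrix}0&\mathbf{1}\\ \mathbf{1}^\top&\mathsf{A}_1\end{bmatrix}$ and $\widetilde{\mathsf{A}}_g=\begin{bmatrix}0&0\\0&\mathsf{A}_g\end{bmatrix}$ for $g\neq1$. *)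

theory Defs
  imports
    Complex_Main
    "HOL-Library.Disjoint_Sets"
    "HOL-Library.Function_Algebras"
    "HOL-Algebra.Coset"
begin

section \<open>Association schemes\<close>

text \<open>
  A scheme is given by its vertex set and its set of relations; association schemes are
  commutative, and the last conjunct asks for intersection numbers symmetric in the
  two lower indices. The blocks of a \<^const>\<open>partition_on\<close> are nonempty.
\<close>

definition assoc_scheme :: "'v set \<Rightarrow> 'v rel set \<Rightarrow> bool" where
  "assoc_scheme V X \<longleftrightarrow>
     finite V \<and> V \<noteq> {} \<and> partition_on (V \<times> V) X \<and>
     Id_on V \<in> X \<and> (\<forall>R\<in>X. converse R \<in> X) \<and>
     (\<exists>p. (\<forall>R\<in>X. \<forall>S\<in>X. \<forall>T\<in>X. \<forall>(x, z)\<in>T.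
              card {y \<in> V. (x, y) \<in> R \<and> (y, z) \<in> S} = p R S T) \<and>
          (\<forall>R\<in>X. \<forall>S\<in>X. \<forall>T\<in>X. p R S T = (p S R T :: nat)))"

definition scheme_iso :: "'v set \<Rightarrow> 'v rel set \<Rightarrow> 'w set \<Rightarrow> 'w rel set \<Rightarrow> bool" where
  "scheme_iso V X W Z \<longleftrightarrow>
     assoc_scheme V X \<and> assoc_scheme W Z \<and>
     (\<exists>\<phi>. bij_betw \<phi> V W \<and> Z = (\<lambda>R. map_prod \<phi> \<phi> ` R) ` X)"

definition thin :: "'v set \<Rightarrow> 'v rel \<Rightarrow> bool" where
  "thin V R \<longleftrightarrow> (\<forall>x\<in>V. card (R `` {x}) = 1)"

definition local_rels :: "'v rel set \<Rightarrow> 'v set \<Rightarrow> 'v rel set" where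
  "local_rels X D = {R \<inter> (D \<times> D) | R. R \<in> X} - {{}}"


section \<open>Matrices indexed by sets\<close>

text \<open>
  A matrix with rows and columns indexed by \<open>V\<close> is a function of two arguments that
  vanishes outside \<open>V \<times> V\<close>. Sums of matrices are pointwise sums of functions.
\<close>

definition adj :: "'v rel \<Rightarrow> 'v \<Rightarrow> 'v \<Rightarrow> complex" where
  "adj R x y = (if (x, y) \<in> R then 1 else 0)"

definition mat_one :: "'v set \<Rightarrow> 'v \<Rightarrow> 'v \<Rightarrow> complex" where
  "mat_one V x y = (if x \<in> V \<and> x = y then 1 else 0)"

definition mat_mult ::
    "'v set \<Rightarrow> ('v \<Rightarrow> 'v \<Rightarrow> complex) \<Rightarrow> ('v \<Rightarrow> 'v \<Rightarrow> complex) \<Rightarrow> 'v \<Rightarrow> 'v \<Rightarrow> complex" where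
  "mat_mult V M N x z = (\<Sum>y\<in>V. M x y * N y z)"

definition kron ::
    "('v \<Rightarrow> 'v \<Rightarrow> complex) \<Rightarrow> ('g \<Rightarrow> 'g \<Rightarrow> complex) \<Rightarrow> 'v \<times> 'g \<Rightarrow> 'v \<times> 'g \<Rightarrow> complex" where
  "kron M P = (\<lambda>(i, g) (j, h). M i j * P g h)"

definition thin_radical :: "'v set \<Rightarrow> 'v rel set \<Rightarrow> ('v \<Rightarrow> 'v \<Rightarrow> complex) monoid" where
  "thin_radical V X =
     \<lparr>carrier = adj ` {R \<in> X. thin V R}, mult = mat_mult V, one = mat_one V\<rparr>"

definition perm_mat :: "('g, 'm) monoid_scheme \<Rightarrow> 'g \<Rightarrow> 'g \<Rightarrow> 'g \<Rightarrow> complex" where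
  "perm_mat G k g h =
     (if g \<in> carrier G \<and> h \<in> carrier G \<and> g \<otimes>\<^bsub>G\<^esub> k = h then 1 else 0)"


section \<open>Roux matrices and roux schemes\<close>

text \<open>
  Elements of the group ring \<open>\<complex>[G]\<close> of a finite group are functions \<open>'g \<Rightarrow> complex\<close> vanishing
  outside \<open>carrier G\<close>. The zero element and addition are those of functions.
\<close>

definition gr_single :: "'g \<Rightarrow> 'g \<Rightarrow> complex" where
  "gr_single g h = (if h = g then 1 else 0)"

definition gr_mult ::
    "('g, 'm) monoid_scheme \<Rightarrow> ('g \<Rightarrow> complex) \<Rightarrow> ('g \<Rightarrow> complex) \<Rightarrow> 'g \<Rightarrow> complex" where
  "gr_mult G a b h =
     (\<Sum>u\<in>carrier G. \<Sum>v\<in>carrier G. if u \<otimes>\<^bsub>G\<^esub> v = h then a u * b v else 0)"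

type_synonym 'g gr_mat = "nat \<Rightarrow> nat \<Rightarrow> 'g \<Rightarrow> complex"

definition grm_one :: "('g, 'm) monoid_scheme \<Rightarrow> nat \<Rightarrow> 'g gr_mat" where
  "grm_one G n i j = (if i < n \<and> i = j then gr_single \<one>\<^bsub>G\<^esub> else 0)"

definition grm_mult :: "('g, 'm) monoid_scheme \<Rightarrow> nat \<Rightarrow> 'g gr_mat \<Rightarrow> 'g gr_mat \<Rightarrow> 'g gr_mat" where
  "grm_mult G n M N i j = (\<Sum>l<n. gr_mult G (M i l) (N l j))"

text \<open>The matrix \<open>g M\<close> for a group element \<open>g\<close>.\<close>

definition grm_act :: "('g, 'm) monoid_scheme \<Rightarrow> 'g \<Rightarrow> 'g gr_mat \<Rightarrow> 'g gr_mat" where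
  "grm_act G g M i j = gr_mult G (gr_single g) (M i j)"

definition roux_span :: "('g, 'm) monoid_scheme \<Rightarrow> nat \<Rightarrow> 'g gr_mat \<Rightarrow> 'g gr_mat set" where
  "roux_span G n B =
     module.span (\<lambda>(c :: complex) M i j g. c * M i j g)
       ({grm_act G g (grm_one G n) | g. g \<in> carrier G} \<union> {grm_act G g B | g. g \<in> carrier G})"

text \<open>
  The span always contains the identity matrix, so it is an algebra as soon as it is closed under
  multiplication.
\<close>

definition roux_matrix :: "('g, 'm) monoid_scheme \<Rightarrow> nat \<Rightarrow> 'g gr_mat \<Rightarrow> bool" where
  "roux_matrix G n B \<longleftrightarrow>
     comm_group G \<and> finite (carrier G) \<and>
     (\<forall>i j. \<not> (i < n \<and> j < n) \<longrightarrow> B i j = 0) \<and>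
     (\<forall>i<n. B i i = 0) \<and>
     (\<forall>i<n. \<forall>j<n. i \<noteq> j \<longrightarrow>
        (\<exists>g\<in>carrier G. B i j = gr_single g \<and> B j i = gr_single (inv\<^bsub>G\<^esub> g))) \<and>
     (\<forall>M\<in>roux_span G n B. \<forall>N\<in>roux_span G n B. grm_mult G n M N \<in> roux_span G n B)"

text \<open>The linear extension of the regular representation \<^const>\<open>perm_mat\<close>, applied entrywise.\<close>

definition reg_rep ::
    "('g, 'm) monoid_scheme \<Rightarrow> 'g gr_mat \<Rightarrow> nat \<times> 'g \<Rightarrow> nat \<times> 'g \<Rightarrow> complex" where
  "reg_rep G M = (\<lambda>(i, h) (j, h'). \<Sum>g\<in>carrier G. M i j g * perm_mat G g h h')"

definition roux_scheme :: "('g, 'm) monoid_scheme \<Rightarrow> 'v set \<Rightarrow> 'v rel set \<Rightarrow> bool" where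
  "roux_scheme G V X \<longleftrightarrow>
     (\<exists>n B Z. roux_matrix G n B \<and>
        adj ` Z = {reg_rep G (grm_act G g (grm_one G n)) | g. g \<in> carrier G}
                    \<union> {reg_rep G (grm_act G g B) | g. g \<in> carrier G} \<and>
        scheme_iso ({..<n} \<times> carrier G) Z V X)"


section \<open>The scheme built from a labelled scheme and a group\<close>

text \<open>
  Here \<open>R\<close> labels the non-diagonal relations of a scheme on \<open>D\<close> by elements of \<open>G\<close>; the extra
  point is \<^const>\<open>None\<close>.
\<close>

fun bordered_adj ::
    "('g, 'm) monoid_scheme \<Rightarrow> 'v set \<Rightarrow> ('g \<Rightarrow> 'v rel) \<Rightarrow> 'g \<Rightarrow> 'v option \<Rightarrow> 'v option \<Rightarrow> complex"
where
  "bordered_adj G D R g None None = 0"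
| "bordered_adj G D R g None (Some z) = (if g = \<one>\<^bsub>G\<^esub> \<and> z \<in> D then 1 else 0)"
| "bordered_adj G D R g (Some y) None = (if g = \<one>\<^bsub>G\<^esub> \<and> y \<in> D then 1 else 0)"
| "bordered_adj G D R g (Some y) (Some z) = adj (R g) y z"

definition hat_vertices :: "('g, 'm) monoid_scheme \<Rightarrow> 'v set \<Rightarrow> ('v option \<times> 'g) set" where
  "hat_vertices G D = insert None (Some ` D) \<times> carrier G"

definition hat_T ::
    "('g, 'm) monoid_scheme \<Rightarrow> 'v set \<Rightarrow> 'g \<Rightarrow> 'v option \<times> 'g \<Rightarrow> 'v option \<times> 'g \<Rightarrow> complex" where
  "hat_T G D k = kron (mat_one (insert None (Some ` D))) (perm_mat G k)"

definition hat_S ::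
    "('g, 'm) monoid_scheme \<Rightarrow> 'v set \<Rightarrow> ('g \<Rightarrow> 'v rel) \<Rightarrow> 'g
      \<Rightarrow> 'v option \<times> 'g \<Rightarrow> 'v option \<times> 'g \<Rightarrow> complex" where
  "hat_S G D R k =
     (\<Sum>l\<in>carrier G. kron (bordered_adj G D R l) (perm_mat G (k \<otimes>\<^bsub>G\<^esub> l)))"

end

theory Submission imports Defs begin

text \<open>
  A roux scheme lives on \<open>I \<times> \<Gamma>\<close>: vertices \<open>(i, g)\<close> and \<open>(i, g k)\<close> are related by \<open>T k\<close>, and for
  \<open>i \<noteq> j\<close> the vertices \<open>(i, g)\<close> and \<open>(j, g k b i j)\<close> are related by \<open>S k\<close>, where \<open>b i j\<close> are the
  entries of the roux matrix. Multiplying the second coordinate of the \<open>i\<close>-th fibre by \<open>b i o\<close>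
  conjugates the roux matrix so that the row of the fibre \<open>o\<close> of \<open>x\<close> becomes trivial. Then the
  neighbourhood \<open>D\<close> meets every other fibre once, in vertices with the same second coordinate,
  so two distinct points of \<open>D\<close> in the fibres \<open>i\<close> and \<open>j\<close> are related by \<open>S\<close> of the inverse of
  \<open>b i j\<close>. Hence the local relations are the level sets of \<open>b\<close>; if there are \<open>|G|\<close> of them, they are
  labelled by \<open>G\<close>, and replacing each fibre by its point of \<open>D\<close> (by \<open>\<infinity>\<close> for the fibre of \<open>x\<close>) is
  the isomorphism. A relation \<open>S k\<close> has valency \<open>|I| - 1\<close>, so once one of them is thick the thin
  radical is the set of all \<open>T k\<close>, which is a copy of \<open>\<Gamma>\<close>.
\<close>

section \<open>Matrices of relations and transport of schemes\<close>

lemma inj_adj: "inj (adj :: 'v rel \<Rightarrow> _)"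
proof (rule injI)
  fix R S :: "'v rel"
  assume eq: "adj R = adj S"
  have "(x, y) \<in> R \<longleftrightarrow> (x, y) \<in> S" for x y
    using fun_cong[OF fun_cong[OF eq], of x y] by (simp add: adj_def split: if_splits)
  then show "R = S" by auto
qed

lemma mat_one_eq_adj: "mat_one V = adj (Id_on V)"
  by (intro ext) (auto simp: mat_one_def adj_def)

text \<open>An entry of the product counts middle points. Single-valuedness of \<open>R\<close>
  allows at most one, so the product is again a 0/1 matrix; without it multiplicities could
  occur.\<close>

lemma mat_mult_adj_single_valued:
  assumes "finite V" "R \<subseteq> V \<times> V" "single_valued R"
  shows "mat_mult V (adj R) (adj S) = adj (R O S)"
proof (intro ext)
  fix x z
  show "mat_mult V (adj R) (adj S) x z = adj (R O S) x z"
  proof (cases "\<exists>y. (x, y) \<in> R")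
    case True
    then obtain y where y: "(x, y) \<in> R" by blast
    then have u: "(x, y') \<in> R \<longleftrightarrow> y' = y" for y'
      using assms(3) by (auto simp: single_valued_def)
    have "mat_mult V (adj R) (adj S) x z = (\<Sum>y'\<in>V. if y' = y then adj S y z else 0)"
      unfolding mat_mult_def by (intro sum.cong) (auto simp: adj_def u)
    also have "\<dots> = adj S y z" using y assms by auto
    also have "\<dots> = adj (R O S) x z" using u by (auto simp: adj_def)
    finally show ?thesis .
  next
    case False
    then show ?thesis by (auto simp: mat_mult_def adj_def relcomp_unfold)
  qed
qed

lemma mem_map_prod_image:
  assumes "inj_on f V" "R \<subseteq> V \<times> V" "x \<in> V" "y \<in> V"
  shows "(f x, f y) \<in> map_prod f f ` R \<longleftrightarrow> (x, y) \<in> R"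
proof
  assume "(f x, f y) \<in> map_prod f f ` R"
  then obtain u v where "(u, v) \<in> R" "f x = f u" "f y = f v" by auto
  then show "(x, y) \<in> R" using assms by (auto dest!: inj_onD[OF assms(1)])
qed force

text \<open>Used to recognise the target matrices: it is enough to compare entries after pulling
  back along \<open>f\<close> and to check that the matrix vanishes outside
  \<open>W\<close>.\<close>

lemma adj_map_prod_image:
  assumes f: "bij_betw f V W" and R: "R \<subseteq> V \<times> V"
    and in_W: "\<And>x y. x \<in> V \<Longrightarrow> y \<in> V \<Longrightarrow> M (f x) (f y) = adj R x y"
    and out: "\<And>a b. a \<notin> W \<or> b \<notin> W \<Longrightarrow> M a b = 0"
  shows "adj (map_prod f f ` R) = M"
proof (intro ext)
  fix a b
  show "adj (map_prod f f ` R) a b = M a b"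
  proof (cases "a \<in> W \<and> b \<in> W")
    case True
    then obtain x y where xy: "x \<in> V" "y \<in> V" "a = f x" "b = f y"
      using f by (auto simp: bij_betw_def)
    then show ?thesis
      using in_W[of x y] mem_map_prod_image[OF _ R, of f x y] f
      by (simp add: adj_def bij_betw_def)
  next
    case False
    then have "(a, b) \<notin> map_prod f f ` R"
      using f R by (auto simp: bij_betw_def)
    then show ?thesis using out[of a b] False by (auto simp: adj_def)
  qed
qed

text \<open>\<open>scheme_iso\<close> asks that both sides be schemes. Transport along the bijection
  supplies this for the target without computing its intersection numbers.\<close>

lemma assoc_scheme_bij_image:
  assumes "assoc_scheme V X" and f: "bij_betw f V W"
  shows "assoc_scheme W ((\<lambda>R. map_prod f f ` R) ` X)"
proof -
  let ?F = "\<lambda>R. map_prod f f ` R"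
  have fin: "finite V" "V \<noteq> {}" and part: "partition_on (V \<times> V) X"
    and Id: "Id_on V \<in> X" and conv: "\<And>R. R \<in> X \<Longrightarrow> converse R \<in> X"
    using assms(1) by (simp_all add: assoc_scheme_def)
  obtain p where p0: "\<forall>R\<in>X. \<forall>S\<in>X. \<forall>T\<in>X. \<forall>(x, z)\<in>T.
      card {y \<in> V. (x, y) \<in> R \<and> (y, z) \<in> S} = p R S T"
    and comm: "\<forall>R\<in>X. \<forall>S\<in>X. \<forall>T\<in>X. p R S T = (p S R T :: nat)"
    using assms(1) unfolding assoc_scheme_def by (elim conjE exE)
  have p: "card {y \<in> V. (x, y) \<in> R \<and> (y, z) \<in> S} = p R S T"
    if "R \<in> X" "S \<in> X" "T \<in> X" "(x, z) \<in> T" for R S T x z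
    using p0[rule_format, OF that(1-3)] that(4) by fast
  have inj: "inj_on f V" and W: "W = f ` V" using f by (auto simp: bij_betw_def)
  have sub: "R \<subseteq> V \<times> V" if "R \<in> X" for R
    using part that by (auto simp: partition_on_def)
  have injF: "inj_on (map_prod f f) (V \<times> V)" using inj by (simp add: map_prod_inj_on)
  have partF: "partition_on (W \<times> W) (?F ` X)"
    using partition_on_inj_image[OF part injF] partition_onD3[OF part]
    unfolding W by (simp add: map_prod_surj_on image_iff)
  have injX: "inj_on ?F X"
    by (rule inj_onI) (metis injF sub inj_on_image_eq_iff)
  \<comment> \<open>Intersection numbers depend on relations, so those of the image scheme are read
    off by first going back to the original relations.\<close>
  define G where "G = the_inv_into X ?F"
  have G: "G (?F R) = R" if "R \<in> X" for R
    unfolding G_def by (rule the_inv_into_f_f[OF injX that])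
  have "Id_on W = ?F (Id_on V)" unfolding W by (auto simp: image_iff Bex_def)
  then have IdF: "Id_on W \<in> ?F ` X" using Id by blast
  have "converse (?F R) = ?F (converse R)" for R by force
  then have convF: "\<forall>R\<in>?F ` X. converse R \<in> ?F ` X" using conv by auto
  have card: "card {b \<in> W. (f x, b) \<in> ?F R \<and> (b, f z) \<in> ?F S} = p R S T"
    if R: "R \<in> X" and S: "S \<in> X" and T: "T \<in> X" and xz: "(x, z) \<in> T" for R S T x z
  proof -
    have V: "x \<in> V" "z \<in> V" using sub[OF T] xz by auto
    have img: "{b \<in> f ` V. P b} = f ` {y \<in> V. P (f y)}" for P by blast
    have "{b \<in> W. (f x, b) \<in> ?F R \<and> (b, f z) \<in> ?F S}
        = f ` {y \<in> V. (f x, f y) \<in> ?F R \<and> (f y, f z) \<in> ?F S}"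
      unfolding W by (rule img)
    also have "{y \<in> V. (f x, f y) \<in> ?F R \<and> (f y, f z) \<in> ?F S} = {y \<in> V. (x, y) \<in> R \<and> (y, z) \<in> S}"
      by (intro Collect_cong conj_cong refl)
        (simp_all only: mem_map_prod_image[OF inj sub[OF R] V(1)] mem_map_prod_image[OF inj sub[OF S] _ V(2)])
    finally show ?thesis
      using p[OF R S T xz] by (simp add: card_image inj_on_subset[OF inj])
  qed
  have "\<exists>p'. (\<forall>R\<in>?F ` X. \<forall>S\<in>?F ` X. \<forall>T\<in>?F ` X. \<forall>(x, z)\<in>T.
              card {y \<in> W. (x, y) \<in> R \<and> (y, z) \<in> S} = p' R S T) \<and>
          (\<forall>R\<in>?F ` X. \<forall>S\<in>?F ` X. \<forall>T\<in>?F ` X. p' R S T = (p' S R T :: nat))"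
  proof (intro exI[of _ "\<lambda>R S T. p (G R) (G S) (G T)"] conjI)
    show "\<forall>R\<in>?F ` X. \<forall>S\<in>?F ` X. \<forall>T\<in>?F ` X. \<forall>(x, z)\<in>T.
        card {y \<in> W. (x, y) \<in> R \<and> (y, z) \<in> S} = p (G R) (G S) (G T)"
    proof (intro ballI)
      fix R' S' T' w
      assume "R' \<in> ?F ` X" "S' \<in> ?F ` X" "T' \<in> ?F ` X" and w: "w \<in> T'"
      then obtain R S T where RST: "R \<in> X" "R' = ?F R" "S \<in> X" "S' = ?F S" "T \<in> X" "T' = ?F T"
        by (elim imageE)
      then obtain x z where "(x, z) \<in> T" "w = (f x, f z)" using w by auto
      then show "case w of (x, z) \<Rightarrow>
          card {y \<in> W. (x, y) \<in> R' \<and> (y, z) \<in> S'} = p (G R') (G S') (G T')"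
        using card[of R S T x z] RST by (simp add: G)
    qed
    show "\<forall>R\<in>?F ` X. \<forall>S\<in>?F ` X. \<forall>T\<in>?F ` X. p (G R) (G S) (G T) = p (G S) (G R) (G T)"
      using comm by (simp add: G)
  qed
  then show ?thesis
    unfolding assoc_scheme_def using fin partF IdF convF W by simp
qed


section \<open>Roux schemes in coordinates\<close>

text \<open>The fibre \<open>p\<close> and the group coordinate \<open>q\<close> are functions on an
  arbitrary \<open>V\<close>, not projections of a product. A change of coordinates can then replace
  \<open>q\<close> and \<open>b\<close> while \<open>V\<close> and \<open>X\<close> stay
  fixed.\<close>

definition fibre_rel ::
    "('g, 'm) monoid_scheme \<Rightarrow> 'v set \<Rightarrow> ('v \<Rightarrow> 'i) \<Rightarrow> ('v \<Rightarrow> 'g) \<Rightarrow> 'g \<Rightarrow> 'v rel" where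
  "fibre_rel \<Gamma> V p q k = {(u, v). u \<in> V \<and> v \<in> V \<and> p u = p v \<and> q v = q u \<otimes>\<^bsub>\<Gamma>\<^esub> k}"

definition cross_rel ::
    "('g, 'm) monoid_scheme \<Rightarrow> 'v set \<Rightarrow> ('v \<Rightarrow> 'i) \<Rightarrow> ('v \<Rightarrow> 'g) \<Rightarrow> ('i \<Rightarrow> 'i \<Rightarrow> 'g)
      \<Rightarrow> 'g \<Rightarrow> 'v rel" where
  "cross_rel \<Gamma> V p q b k =
     {(u, v). u \<in> V \<and> v \<in> V \<and> p u \<noteq> p v \<and> q v = q u \<otimes>\<^bsub>\<Gamma>\<^esub> k \<otimes>\<^bsub>\<Gamma>\<^esub> b (p u) (p v)}"

locale roux_coordinates = comm_group \<Gamma>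
  for \<Gamma> :: "('g, 'm) monoid_scheme" (structure) +
  fixes V :: "'v set" and X :: "'v rel set" and I :: "'i set"
    and p :: "'v \<Rightarrow> 'i" and q :: "'v \<Rightarrow> 'g" and b :: "'i \<Rightarrow> 'i \<Rightarrow> 'g"
  assumes finite_carrier: "finite (carrier \<Gamma>)"
    and scheme: "assoc_scheme V X"
    and coord: "bij_betw (\<lambda>u. (p u, q u)) V (I \<times> carrier \<Gamma>)"
    and b_closed: "i \<in> I \<Longrightarrow> j \<in> I \<Longrightarrow> b i j \<in> carrier \<Gamma>"
    and b_diag: \<comment> \<open>a convention: \<open>cross_rel\<close> never looks at the diagonal\<close>
       "i \<in> I \<Longrightarrow> b i i = \<one>"
    and b_swap: "i \<in> I \<Longrightarrow> j \<in> I \<Longrightarrow> b j i = inv (b i j)"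
    and rels: "X = fibre_rel \<Gamma> V p q ` carrier \<Gamma> \<union> cross_rel \<Gamma> V p q b ` carrier \<Gamma>"

text \<open>Each entry of \<open>g I\<close> or \<open>g B\<close> is zero or a single group
  element, so the regular representation turns these matrices into adjacency matrices of fibre and
  cross relations. Injectivity of \<open>adj\<close> then determines \<open>Z\<close>.\<close>

lemma roux_scheme_coordinates:
  fixes \<Gamma> :: "('g, 'm) monoid_scheme" (structure)
  assumes "roux_scheme \<Gamma> V X"
  obtains I :: "nat set" and p q b where "roux_coordinates \<Gamma> V X I p q b"
proof -
  obtain n B Z where B: "roux_matrix \<Gamma> n B"
    and Z: "adj ` Z = {reg_rep \<Gamma> (grm_act \<Gamma> g (grm_one \<Gamma> n)) | g. g \<in> carrier \<Gamma>}
                    \<union> {reg_rep \<Gamma> (grm_act \<Gamma> g B) | g. g \<in> carrier \<Gamma>}"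
    and iso: "scheme_iso ({..<n} \<times> carrier \<Gamma>) Z V X"
    using assms unfolding roux_scheme_def by blast
  have "comm_group \<Gamma>" and fin: "finite (carrier \<Gamma>)" using B by (auto simp: roux_matrix_def)
  then interpret comm_group \<Gamma> by simp
  have Bout: "B i j = 0" if "\<not> (i < n \<and> j < n \<and> i \<noteq> j)" for i j
    using B that unfolding roux_matrix_def by metis
  have "\<forall>i j. \<exists>g. i < n \<longrightarrow> j < n \<longrightarrow> i \<noteq> j \<longrightarrow>
      g \<in> carrier \<Gamma> \<and> B i j = gr_single g \<and> B j i = gr_single (inv g)"
    using B unfolding roux_matrix_def by metis
  then obtain c where c: "\<And>i j. i < n \<Longrightarrow> j < n \<Longrightarrow> i \<noteq> j \<Longrightarrow>
      c i j \<in> carrier \<Gamma> \<and> B i j = gr_single (c i j) \<and> B j i = gr_single (inv (c i j))"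
    by metis
  \<comment> \<open>\<open>B\<close> is zero on the diagonal and \<open>c\<close> is unspecified
    there; the value \<open>\<one>\<close> keeps \<open>b\<close> closed and
    inverse-symmetric.\<close>
  define b where "b i j = (if i = j then \<one> else c i j)" for i j
  have single_inj: "g = h" if "gr_single g = gr_single h" for g h :: 'g
    using fun_cong[OF that, of h] by (simp add: gr_single_def split: if_splits)
  have mult_single: "gr_mult \<Gamma> (gr_single g) (gr_single h) = gr_single (g \<otimes> h)"
    if "g \<in> carrier \<Gamma>" "h \<in> carrier \<Gamma>" for g h
  proof
    fix w
    have "gr_mult \<Gamma> (gr_single g) (gr_single h) w
        = (\<Sum>u\<in>carrier \<Gamma>. if u = g then (\<Sum>v\<in>carrier \<Gamma>. if v = h then gr_single (g \<otimes> h) w else 0) else 0)"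
      unfolding gr_mult_def by (intro sum.cong refl) (auto simp: gr_single_def intro!: sum.cong sum.neutral)
    then show "gr_mult \<Gamma> (gr_single g) (gr_single h) w = gr_single (g \<otimes> h) w"
      using that fin by simp
  qed
  have mult_0: "gr_mult \<Gamma> a 0 = 0" for a
    by (intro ext) (simp add: gr_mult_def cong: if_cong)
  have rep_single: "(\<Sum>g\<in>carrier \<Gamma>. gr_single k g * perm_mat \<Gamma> g h h') = perm_mat \<Gamma> k h h'"
    if "k \<in> carrier \<Gamma>" for k h h'
  proof -
    have "(\<Sum>g\<in>carrier \<Gamma>. gr_single k g * perm_mat \<Gamma> g h h')
        = (\<Sum>g\<in>carrier \<Gamma>. if g = k then perm_mat \<Gamma> k h h' else 0)"
      by (intro sum.cong) (auto simp: gr_single_def)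
    then show ?thesis using that fin by simp
  qed
  let ?P = "{..<n} \<times> carrier \<Gamma>"
  let ?T = "fibre_rel \<Gamma> ?P fst snd" and ?S = "cross_rel \<Gamma> ?P fst snd b"
  have T: "reg_rep \<Gamma> (grm_act \<Gamma> g (grm_one \<Gamma> n)) = adj (?T g)" if g: "g \<in> carrier \<Gamma>" for g
  proof (intro ext)
    fix u v :: "nat \<times> 'g"
    obtain i h j h' where uv: "u = (i, h)" "v = (j, h')" by fastforce
    show "reg_rep \<Gamma> (grm_act \<Gamma> g (grm_one \<Gamma> n)) u v = adj (?T g) u v"
      using g by (simp add: uv reg_rep_def grm_act_def grm_one_def mult_single mult_0 rep_single)
        (auto simp: perm_mat_def adj_def fibre_rel_def)
  qed
  have S: "reg_rep \<Gamma> (grm_act \<Gamma> g B) = adj (?S g)" if g: "g \<in> carrier \<Gamma>" for g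
  proof (intro ext)
    fix u v :: "nat \<times> 'g"
    obtain i h j h' where uv: "u = (i, h)" "v = (j, h')" by fastforce
    show "reg_rep \<Gamma> (grm_act \<Gamma> g B) u v = adj (?S g) u v"
    proof (cases "i < n \<and> j < n \<and> i \<noteq> j")
      case True
      then show ?thesis
        using c[of i j] g
        by (simp add: uv reg_rep_def grm_act_def mult_single rep_single)
          (auto simp: perm_mat_def adj_def cross_rel_def b_def m_assoc)
    next
      case False
      then show ?thesis
        using Bout[OF False] by (auto simp: uv reg_rep_def grm_act_def mult_0 adj_def cross_rel_def)
    qed
  qed
  have "adj ` Z = adj ` (?T ` carrier \<Gamma> \<union> ?S ` carrier \<Gamma>)"
    unfolding Z image_Un image_image using T S by (intro arg_cong2[of _ _ _ _ "(\<union>)"]) force+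
  then have Z_eq: "Z = ?T ` carrier \<Gamma> \<union> ?S ` carrier \<Gamma>"
    by (simp add: inj_image_eq_iff[OF inj_adj])
  obtain f where f: "bij_betw f ?P V" and X: "X = (\<lambda>R. map_prod f f ` R) ` Z"
    and sch: "assoc_scheme V X" using iso unfolding scheme_iso_def by blast
  \<comment> \<open>A vertex of \<open>V\<close> takes the coordinates of its preimage in the
    standard vertex set.\<close>
  define e where "e = the_inv_into ?P f"
  have e: "bij_betw e V ?P" unfolding e_def by (rule bij_betw_the_inv_into[OF f])
  have ef: "e (f w) = w" if "w \<in> ?P" for w
    unfolding e_def using f that by (simp add: bij_betw_def the_inv_into_f_f)
  have V: "V = f ` ?P" using f by (simp add: bij_betw_def)
  have ef': "e (f (i, h)) = (i, h)" if "i < n" "h \<in> carrier \<Gamma>" for i h using ef that by simp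
  have Tf: "map_prod f f ` ?T k = fibre_rel \<Gamma> V (fst \<circ> e) (snd \<circ> e) k" for k
    unfolding fibre_rel_def V by (auto simp: ef' image_iff Bex_def)
  have Sf: "map_prod f f ` ?S k = cross_rel \<Gamma> V (fst \<circ> e) (snd \<circ> e) b k" for k
    unfolding cross_rel_def V by (auto simp: ef' image_iff Bex_def)
  have "roux_coordinates \<Gamma> V X {..<n} (fst \<circ> e) (snd \<circ> e) b"
  proof
    show "bij_betw (\<lambda>u. ((fst \<circ> e) u, (snd \<circ> e) u)) V ?P" using e by simp
    show "X = fibre_rel \<Gamma> V (fst \<circ> e) (snd \<circ> e) ` carrier \<Gamma> \<union> cross_rel \<Gamma> V (fst \<circ> e) (snd \<circ> e) b ` carrier \<Gamma>"
      unfolding X Z_eq image_Un image_image Tf Sf ..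
    show "b i j \<in> carrier \<Gamma>" if "i \<in> {..<n}" "j \<in> {..<n}" for i j
      using that c[of i j] by (auto simp: b_def)
    \<comment> \<open>\<open>c i j\<close> and \<open>c j i\<close> were chosen independently. Both
      choices describe the entry \<open>B j i\<close>, so injectivity of \<open>gr_single\<close>
      relates them.\<close>
    show "b j i = inv (b i j)" if "i \<in> {..<n}" "j \<in> {..<n}" for i j
      using that c[of i j] c[of j i] single_inj[of "c j i" "inv (c i j)"] by (auto simp: b_def)
  qed (use fin sch in \<open>auto simp: b_def\<close>)
  then show ?thesis using that by blast
qed

context roux_coordinates
begin

section \<open>Coordinates of vertices and their normalization\<close>

lemma p_in [simp]: "u \<in> V \<Longrightarrow> p u \<in> I" and q_in [simp]: "u \<in> V \<Longrightarrow> q u \<in> carrier \<Gamma>"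
  using coord by (auto simp: bij_betw_def)

lemma coord_eqI: "u \<in> V \<Longrightarrow> v \<in> V \<Longrightarrow> p u = p v \<Longrightarrow> q u = q v \<Longrightarrow> u = v"
  using coord by (auto simp: bij_betw_def inj_on_def)

lemma coord_obtain:
  assumes "i \<in> I" "g \<in> carrier \<Gamma>"
  obtains u where "u \<in> V" "p u = i" "q u = g"
proof -
  have "(i, g) \<in> (\<lambda>u. (p u, q u)) ` V" using assms coord by (auto simp: bij_betw_def)
  then show ?thesis using that by auto
qed

text \<open>This is conjugation by a diagonal matrix of group elements. Both ends of a fibre
  relation receive the same factor, and the new \<open>b\<close> absorbs the factors at the ends of
  a cross relation, so every relation even keeps its label \<open>k\<close>. The new row of
  \<open>z\<close> has entries \<open>b z z \<otimes> b z i \<otimes> b i z\<close>, which are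
  trivial.\<close>

lemma normalize:
  assumes z: "z \<in> I"
  shows "roux_coordinates \<Gamma> V X I p (\<lambda>u. q u \<otimes> b (p u) z) (\<lambda>i j. b z i \<otimes> b i j \<otimes> b j z)"
    (is "roux_coordinates _ _ _ _ _ ?q ?b")
proof
  show "bij_betw (\<lambda>u. (p u, ?q u)) V (I \<times> carrier \<Gamma>)"
  proof (rule bij_betw_imageI)
    show "inj_on (\<lambda>u. (p u, ?q u)) V"
      by (rule inj_onI) (use z b_closed coord_eqI in \<open>auto\<close>)
    have "(i, g) \<in> (\<lambda>u. (p u, ?q u)) ` V" if ig: "i \<in> I" "g \<in> carrier \<Gamma>" for i g
    proof -
      obtain u where "u \<in> V" "p u = i" "q u = g \<otimes> inv (b i z)"
        using coord_obtain[of i "g \<otimes> inv (b i z)"] ig z b_closed by auto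
      then have "?q u = g" using ig z b_closed by (simp add: m_assoc)
      then show ?thesis using \<open>u \<in> V\<close> \<open>p u = i\<close> by force
    qed
    then show "(\<lambda>u. (p u, ?q u)) ` V = I \<times> carrier \<Gamma>" using z b_closed by auto
  qed
  have fib: "fibre_rel \<Gamma> V p ?q k = fibre_rel \<Gamma> V p q k" if k: "k \<in> carrier \<Gamma>" for k
  proof -
    have "?q v = ?q u \<otimes> k \<longleftrightarrow> q v = q u \<otimes> k" if "u \<in> V" "v \<in> V" "p u = p v" for u v
    proof -
      have "?q u \<otimes> k = q u \<otimes> k \<otimes> b (p v) z"
        using that z k b_closed by (simp add: m_ac)
      then show ?thesis using that z k b_closed by simp
    qed
    then show ?thesis unfolding fibre_rel_def by blast
  qed
  have cross: "cross_rel \<Gamma> V p ?q ?b k = cross_rel \<Gamma> V p q b k" if k: "k \<in> carrier \<Gamma>" for k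
  proof -
    have "?q v = ?q u \<otimes> k \<otimes> ?b (p u) (p v) \<longleftrightarrow> q v = q u \<otimes> k \<otimes> b (p u) (p v)"
      if uv: "u \<in> V" "v \<in> V" for u v
    proof -
      have c: "b (p u) z \<in> carrier \<Gamma>" "b z (p u) \<in> carrier \<Gamma>" "b (p u) (p v) \<in> carrier \<Gamma>"
        "b (p v) z \<in> carrier \<Gamma>" "q u \<in> carrier \<Gamma>" "q v \<in> carrier \<Gamma>"
        using uv z b_closed by auto
      have one: "b (p u) z \<otimes> b z (p u) = \<one>" using uv z b_closed b_swap[of "p u" z] by simp
      \<comment> \<open>The first factor of the new \<open>b\<close> cancels the factor in the new
        coordinate of \<open>u\<close>; its last factor is the one in the new coordinate of
        \<open>v\<close>.\<close>
      have "?q u \<otimes> k \<otimes> ?b (p u) (p v)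
          = (b (p u) z \<otimes> b z (p u)) \<otimes> (q u \<otimes> k \<otimes> b (p u) (p v) \<otimes> b (p v) z)"
        using c k by (simp add: m_ac)
      also have "\<dots> = q u \<otimes> k \<otimes> b (p u) (p v) \<otimes> b (p v) z"
        unfolding one using c k by simp
      finally show ?thesis using c k by simp
    qed
    then show ?thesis unfolding cross_rel_def by blast
  qed
  show "X = fibre_rel \<Gamma> V p ?q ` carrier \<Gamma> \<union> cross_rel \<Gamma> V p ?q ?b ` carrier \<Gamma>"
    unfolding rels using fib cross by auto
  fix i j assume ij: "i \<in> I" "j \<in> I"
  show "?b i j \<in> carrier \<Gamma>" using ij z b_closed by simp
  show "?b j i = inv (?b i j)"
    using ij z b_closed b_swap[of z i] b_swap[of i j] b_swap[of j z] by (simp add: inv_mult m_ac)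
next
  fix i assume "i \<in> I"
  then show "b z i \<otimes> b i i \<otimes> b i z = \<one>"
    using z b_closed b_diag b_swap[of i z] by simp
qed (use finite_carrier scheme in auto)

section \<open>Valencies of the relations and the thin radical\<close>

abbreviation "T \<equiv> fibre_rel \<Gamma> V p q"
abbreviation "S \<equiv> cross_rel \<Gamma> V p q b"

lemma finite_V: "finite V" and V_nonempty: "V \<noteq> {}"
  using scheme by (simp_all add: assoc_scheme_def)

lemma fibre_rel_subset: "T k \<subseteq> V \<times> V" and cross_rel_subset: "S k \<subseteq> V \<times> V"
  by (auto simp: fibre_rel_def cross_rel_def)

lemma single_valued_fibre_rel: "single_valued (T k)"
  by (rule single_valuedI) (auto simp: fibre_rel_def intro: coord_eqI)

lemma fibre_rel_relcomp:
  assumes "k \<in> carrier \<Gamma>" "l \<in> carrier \<Gamma>"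
  shows "T k O T l = T (k \<otimes> l)"
proof (intro equalityI subrelI)
  fix u w assume "(u, w) \<in> T k O T l"
  then show "(u, w) \<in> T (k \<otimes> l)" using assms by (auto simp: fibre_rel_def m_assoc)
next
  fix u w assume uw: "(u, w) \<in> T (k \<otimes> l)"
  then have u: "u \<in> V" by (auto simp: fibre_rel_def)
  then obtain v where "v \<in> V" "p v = p u" "q v = q u \<otimes> k"
    using coord_obtain[of "p u" "q u \<otimes> k"] assms by auto
  then show "(u, w) \<in> T k O T l"
    using uw assms u by (auto simp: fibre_rel_def m_assoc relcomp_unfold)
qed

lemma fibre_rel_one: "T \<one> = Id_on V"
  by (auto simp: fibre_rel_def Id_on_def intro!: coord_eqI)

lemma inj_on_fibre_rel: "inj_on T (carrier \<Gamma>)"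
proof (rule inj_onI)
  fix k l assume kl: "k \<in> carrier \<Gamma>" "l \<in> carrier \<Gamma>" "T k = T l"
  obtain u where u: "u \<in> V" using V_nonempty by blast
  then obtain v where v: "v \<in> V" "p v = p u" "q v = q u \<otimes> k"
    using coord_obtain[of "p u" "q u \<otimes> k"] kl by auto
  then have "(u, v) \<in> T k" using u by (simp add: fibre_rel_def)
  then have "(u, v) \<in> T l" using kl(3) by simp
  then show "k = l" using u v kl by (auto simp: fibre_rel_def)
qed

lemma thin_fibre_rel:
  assumes "k \<in> carrier \<Gamma>"
  shows "thin V (T k)"
  unfolding thin_def
proof
  fix u assume u: "u \<in> V"
  then obtain v where "v \<in> V" "p v = p u" "q v = q u \<otimes> k"
    using coord_obtain[of "p u" "q u \<otimes> k"] assms by auto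
  then have "T k `` {u} = {v}" using u by (auto simp: fibre_rel_def intro: coord_eqI)
  then show "card (T k `` {u}) = 1" by simp
qed

text \<open>In each fibre other than that of \<open>u\<close> the group coordinate of a neighbour is
  forced, so there is exactly one neighbour.\<close>

lemma card_cross_rel_image:
  assumes "k \<in> carrier \<Gamma>" "u \<in> V"
  shows "card (S k `` {u}) = card I - 1"
proof -
  have "bij_betw p (S k `` {u}) (I - {p u})"
  proof (rule bij_betw_imageI)
    show "inj_on p (S k `` {u})"
      by (rule inj_onI) (auto simp: cross_rel_def intro: coord_eqI)
    have "i \<in> p ` (S k `` {u})" if i: "i \<in> I" "i \<noteq> p u" for i
    proof -
      obtain v where "v \<in> V" "p v = i" "q v = q u \<otimes> k \<otimes> b (p u) i"
        using coord_obtain[of i "q u \<otimes> k \<otimes> b (p u) i"] assms i b_closed by auto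
      then show ?thesis using assms i by (force simp: cross_rel_def)
    qed
    then show "p ` (S k `` {u}) = I - {p u}" by (auto simp: cross_rel_def)
  qed
  then show ?thesis using assms by (simp add: bij_betw_same_card)
qed

lemma thin_cross_rel: "k \<in> carrier \<Gamma> \<Longrightarrow> thin V (S k) \<longleftrightarrow> card I - 1 = 1"
  using card_cross_rel_image V_nonempty by (auto simp: thin_def)

text \<open>The valency of \<open>S k\<close> does not depend on \<open>k\<close>, so one thick
  member makes the whole family thick. With exactly two fibres all \<open>S k\<close> would be thin
  as well.\<close>

lemma thin_rels:
  assumes "k \<in> carrier \<Gamma>" "\<not> thin V (S k)"
  shows "{R \<in> X. thin V R} = T ` carrier \<Gamma>"
  using assms thin_cross_rel thin_fibre_rel unfolding rels by auto

text \<open>The group of the roux matrix is abstract, while the thin radical consists of matrices;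
  this map identifies them.\<close>

definition emb :: "'g \<Rightarrow> 'v \<Rightarrow> 'v \<Rightarrow> complex" where
  "emb k = adj (T k)"

text \<open>The unit is treated separately because the thin radical is not yet known to be a group,
  and \<open>iso\<close> only speaks of carrier and product.\<close>

lemma emb_iso:
  assumes "k \<in> carrier \<Gamma>" "\<not> thin V (S k)"
  shows "emb \<in> iso \<Gamma> (thin_radical V X)" and "emb \<one> = \<one>\<^bsub>thin_radical V X\<^esub>"
proof -
  have "emb k \<otimes>\<^bsub>thin_radical V X\<^esub> emb l = emb (k \<otimes> l)"
    if "k \<in> carrier \<Gamma>" "l \<in> carrier \<Gamma>" for k l
    using that mat_mult_adj_single_valued[OF finite_V fibre_rel_subset single_valued_fibre_rel]
    by (simp add: emb_def thin_radical_def fibre_rel_relcomp)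
  moreover have "bij_betw emb (carrier \<Gamma>) (carrier (thin_radical V X))"
  proof (rule bij_betw_imageI)
    show "inj_on emb (carrier \<Gamma>)"
      by (rule inj_onI) (metis emb_def inj_adj inj_on_fibre_rel inj_onD injD)
    show "emb ` carrier \<Gamma> = carrier (thin_radical V X)"
      by (simp add: thin_radical_def thin_rels[OF assms] emb_def image_image)
  qed
  ultimately show "emb \<in> iso \<Gamma> (thin_radical V X)"
    by (auto simp: iso_def hom_def bij_betw_def)
  show "emb \<one> = \<one>\<^bsub>thin_radical V X\<^esub>"
    by (simp add: emb_def thin_radical_def mat_one_eq_adj fibre_rel_one)
qed

end


section \<open>The neighbourhood of a vertex\<close>

lemma sum_fun_apply: "sum f A x = (\<Sum>a\<in>A. f a x)" for f :: "'a \<Rightarrow> 'b \<Rightarrow> 'c::comm_monoid_add"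
  by (induction A rule: infinite_finite_induct) auto

locale roux_neighbourhood = roux_coordinates \<Gamma> V X I p q b
  for \<Gamma> :: "('g, 'm) monoid_scheme" (structure) and V :: "'v set" and X and I :: "'i set"
    and p q b +
  fixes x :: 'v and k\<^sub>0 :: 'g and D :: "'v set"
  assumes x: "x \<in> V"
    and row: "i \<in> I \<Longrightarrow> b (p x) i = \<one>"
    and k\<^sub>0: "k\<^sub>0 \<in> carrier \<Gamma>"
    and D: "D = S k\<^sub>0 `` {x}"
    and thick: "\<not> thin V (S k\<^sub>0)"
begin

text \<open>The row of the fibre of \<open>x\<close> is trivial, so the group coordinate of a
  neighbour of \<open>x\<close> does not vary with its fibre.\<close>

lemma D_eq: "D = {v \<in> V. p v \<noteq> p x \<and> q v = q x \<otimes> k\<^sub>0}"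
  using x k\<^sub>0 row unfolding D cross_rel_def by auto

lemma D_in_V: "y \<in> D \<Longrightarrow> y \<in> V"
  by (simp add: D_eq)

lemma column: "i \<in> I \<Longrightarrow> b i (p x) = \<one>"
  using b_swap[of "p x" i] row x by simp

lemma D_eqI: "y \<in> D \<Longrightarrow> z \<in> D \<Longrightarrow> p y = p z \<Longrightarrow> y = z"
  by (auto simp: D_eq intro: coord_eqI)

section \<open>Local relations as level sets of the roux matrix\<close>

definition local_rel :: "'g \<Rightarrow> 'v rel" where
  "local_rel m = {(y, z). y \<in> D \<and> z \<in> D \<and> y \<noteq> z \<and> b (p y) (p z) = m}"

lemma converse_local_rel:
  assumes "m \<in> carrier \<Gamma>"
  shows "converse (local_rel m) = local_rel (inv m)"
proof -
  have "b (p y) (p z) = m \<longleftrightarrow> b (p z) (p y) = inv m" if "y \<in> D" "z \<in> D" for y z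
    using that D_in_V b_swap[of "p y" "p z"] b_closed[of "p y" "p z"] assms by (metis inv_inv p_in)
  then show ?thesis by (auto simp: local_rel_def)
qed

lemma fibre_rel_local:
  assumes "m \<in> carrier \<Gamma>"
  shows "T m \<inter> (D \<times> D) = (if m = \<one> then Id_on D else {})"
proof -
  have "(y, z) \<in> T m \<longleftrightarrow> y = z \<and> m = \<one>" if yz: "y \<in> D" "z \<in> D" for y z
  proof -
    have "q y = q z" "q y \<in> carrier \<Gamma>" using yz x k\<^sub>0 by (simp_all add: D_eq)
    then have "q z = q y \<otimes> m \<longleftrightarrow> m = \<one>" using assms by auto
    then show ?thesis using D_eqI[OF yz] yz D_in_V by (auto simp: fibre_rel_def)
  qed
  then show ?thesis by auto
qed

text \<open>The common group coordinate cancels from the equation defining \<open>S m\<close>,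
  leaving \<open>m \<otimes> b (p y) (p z) = \<one>\<close>. Hence the inverse: local relations are
  labelled by values of \<open>b\<close>, not by indices of \<open>S\<close>.\<close>

lemma cross_rel_local:
  assumes m: "m \<in> carrier \<Gamma>"
  shows "S m \<inter> (D \<times> D) = local_rel (inv m)"
proof -
  have "(y, z) \<in> S m \<longleftrightarrow> y \<noteq> z \<and> b (p y) (p z) = inv m" if yz: "y \<in> D" "z \<in> D" for y z
  proof -
    have V: "y \<in> V" "z \<in> V" "b (p y) (p z) \<in> carrier \<Gamma>" "q x \<otimes> k\<^sub>0 \<in> carrier \<Gamma>"
      using yz D_in_V b_closed x k\<^sub>0 by auto
    have "q z = q y \<otimes> m \<otimes> b (p y) (p z) \<longleftrightarrow> m \<otimes> b (p y) (p z) = \<one>"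
      using yz m V by (auto simp: D_eq m_assoc)
    also have "\<dots> \<longleftrightarrow> b (p y) (p z) = inv m"
      using m V by (metis inv_equality inv_inv m_comm r_inv)
    finally show ?thesis using V D_eqI[OF yz] by (auto simp: cross_rel_def)
  qed
  then show ?thesis by (auto simp: local_rel_def)
qed

lemma local_rels_eq:
  assumes "D \<noteq> {}"
  shows "local_rels X D - {Id_on D} = local_rel ` carrier \<Gamma> - {{}}"
proof -
  \<comment> \<open>Nonemptiness of \<open>D\<close> makes the diagonal differ from every level set,
    even an empty one, so deleting it removes none of them.\<close>
  have ne: "local_rel m \<noteq> Id_on D" for m
    using assms by (auto simp: local_rel_def)
  have surj: "local_rel ` carrier \<Gamma> = (\<lambda>m. local_rel (inv m)) ` carrier \<Gamma>"
    by (auto simp: image_iff) (metis inv_closed inv_inv)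
  have "{R \<inter> (D \<times> D) | R. R \<in> X}
      = (\<lambda>m. T m \<inter> (D \<times> D)) ` carrier \<Gamma> \<union> (\<lambda>m. S m \<inter> (D \<times> D)) ` carrier \<Gamma>"
    unfolding rels by blast
  also have "\<dots> = (\<lambda>m. if m = \<one> then Id_on D else {}) ` carrier \<Gamma> \<union> local_rel ` carrier \<Gamma>"
    using fibre_rel_local cross_rel_local unfolding surj by (intro arg_cong2[of _ _ _ _ "(\<union>)"] image_cong) auto
  finally show ?thesis using ne unfolding local_rels_def by auto
qed

text \<open>Pigeonhole: the group has only as many elements as there are classes, so no level set is
  empty and no two coincide.\<close>

lemma bij_local_rel:
  assumes "D \<noteq> {}" "card (local_rels X D - {Id_on D}) = order \<Gamma>"
  shows "bij_betw local_rel (carrier \<Gamma>) (local_rels X D - {Id_on D})"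
proof -
  have card: "card (local_rel ` carrier \<Gamma> - {{}}) = card (carrier \<Gamma>)"
    using assms by (simp add: local_rels_eq order_def)
  have fin: "finite (local_rel ` carrier \<Gamma>)" using finite_carrier by simp
  have eq: "local_rel ` carrier \<Gamma> - {{}} = local_rel ` carrier \<Gamma>"
    by (rule card_seteq[OF fin]) (use card card_image_le[OF finite_carrier, of local_rel] in auto)
  then have "inj_on local_rel (carrier \<Gamma>)"
    using card finite_carrier by (simp add: eq_card_imp_inj_on)
  then show ?thesis using eq by (simp add: bij_betw_def local_rels_eq[OF assms(1)])
qed

section \<open>The isomorphism onto the scheme built from the local scheme\<close>

definition idx :: "'v option \<Rightarrow> 'i" where
  "idx a = (case a of None \<Rightarrow> p x | Some y \<Rightarrow> p y)"

abbreviation "H \<equiv> insert None (Some ` D)"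

text \<open>\<open>D\<close> is a transversal of all fibres except that of \<open>x\<close>, for
  which \<open>None\<close> stands in.\<close>

lemma bij_idx: "bij_betw idx H I"
proof (rule bij_betw_imageI)
  show "inj_on idx H"
    by (rule inj_onI) (auto simp: idx_def D_eq intro: coord_eqI split: option.splits)
  have "i \<in> idx ` H" if i: "i \<in> I" "i \<noteq> p x" for i
  proof -
    obtain v where "v \<in> V" "p v = i" "q v = q x \<otimes> k\<^sub>0"
      using coord_obtain[of i "q x \<otimes> k\<^sub>0"] i x k\<^sub>0 by auto
    then have "Some v \<in> H" "idx (Some v) = i" using i by (auto simp: D_eq idx_def)
    then show ?thesis by blast
  qed
  moreover have "p x \<in> idx ` H" by (rule image_eqI[of _ _ None]) (simp_all add: idx_def)
  moreover have "idx a \<in> I" if "a \<in> H" for a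
    using that x D_in_V by (auto simp: idx_def)
  ultimately show "idx ` H = I" by blast
qed

definition hat_map :: "'v \<Rightarrow> 'v option \<times> ('v \<Rightarrow> 'v \<Rightarrow> complex)" where
  "hat_map u = (the_inv_into H idx (p u), emb (q u))"

abbreviation "G \<equiv> thin_radical V X"

lemma emb_mult: "k \<in> carrier \<Gamma> \<Longrightarrow> l \<in> carrier \<Gamma> \<Longrightarrow> emb k \<otimes>\<^bsub>G\<^esub> emb l = emb (k \<otimes> l)"
  using emb_iso(1)[OF k\<^sub>0 thick] by (auto simp: iso_def hom_def)

lemma emb_bij: "bij_betw emb (carrier \<Gamma>) (carrier G)"
  using emb_iso(1)[OF k\<^sub>0 thick] by (simp add: iso_def)

lemma emb_closed [simp]: "k \<in> carrier \<Gamma> \<Longrightarrow> emb k \<in> carrier G"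
  using emb_bij by (auto simp: bij_betw_def)

lemma emb_eq_iff: "k \<in> carrier \<Gamma> \<Longrightarrow> l \<in> carrier \<Gamma> \<Longrightarrow> emb k = emb l \<longleftrightarrow> k = l"
  using emb_bij by (auto simp: bij_betw_def inj_on_def)

lemma emb_one: "emb \<one> = \<one>\<^bsub>G\<^esub>"
  by (rule emb_iso(2)[OF k\<^sub>0 thick])

lemma emb_inv: "k \<in> carrier \<Gamma> \<Longrightarrow> inv\<^bsub>G\<^esub> (emb k) = emb (inv k)"
proof -
  assume k: "k \<in> carrier \<Gamma>"
  \<comment> \<open>The group structure is transported along \<open>emb\<close>: the image structure
    is the thin radical itself, since \<open>emb\<close> is onto and preserves the unit.\<close>
  have "group (G\<lparr>carrier := emb ` carrier \<Gamma>, one := emb \<one>\<rparr>)"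
    by (rule hom_imp_img_group) (use emb_iso(1)[OF k\<^sub>0 thick] in \<open>simp add: iso_def\<close>)
  moreover have "G\<lparr>carrier := emb ` carrier \<Gamma>, one := emb \<one>\<rparr> = G"
    using emb_bij by (simp add: emb_one bij_betw_def)
  ultimately interpret G: group G by simp
  show ?thesis
    using k by (intro G.inv_equality) (simp_all add: emb_mult emb_one)
qed

lemma perm_mat_emb:
  "k \<in> carrier \<Gamma> \<Longrightarrow> g \<in> carrier \<Gamma> \<Longrightarrow> h \<in> carrier \<Gamma> \<Longrightarrow>
    perm_mat G (emb k) (emb g) (emb h) = (if h = g \<otimes> k then 1 else 0)"
  by (auto simp: perm_mat_def emb_mult emb_eq_iff)

lemma hat_map_bij: "bij_betw hat_map V (hat_vertices G D)"
proof -
  have "bij_betw (map_prod (the_inv_into H idx) emb \<circ> (\<lambda>u. (p u, q u))) V (H \<times> carrier G)"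
    by (intro bij_betw_trans[OF coord] bij_betw_map_prod bij_betw_the_inv_into bij_idx emb_bij)
  then show ?thesis by (simp add: hat_map_def[abs_def] hat_vertices_def comp_def)
qed

lemma idx_inv: "u \<in> V \<Longrightarrow> idx (the_inv_into H idx (p u)) = p u"
  using bij_idx by (simp add: bij_betw_def f_the_inv_into_f)

lemma inv_idx_in: "u \<in> V \<Longrightarrow> the_inv_into H idx (p u) \<in> H"
  using bij_betw_the_inv_into[OF bij_idx] p_in by (auto simp: bij_betw_def simp del: p_in)

lemma adj_hat_T:
  assumes k: "k \<in> carrier \<Gamma>"
  shows "adj (map_prod hat_map hat_map ` T k) = hat_T G D (emb k)"
proof (rule adj_map_prod_image[OF hat_map_bij fibre_rel_subset])
  fix u v assume uv: "u \<in> V" "v \<in> V"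
  have "the_inv_into H idx (p u) = the_inv_into H idx (p v) \<longleftrightarrow> p u = p v"
    using idx_inv[OF uv(1)] idx_inv[OF uv(2)] by metis
  then show "hat_T G D (emb k) (hat_map u) (hat_map v) = adj (T k) u v"
    using uv k inv_idx_in[OF uv(1)]
    by (simp add: hat_T_def hat_map_def kron_def mat_one_def perm_mat_emb adj_def fibre_rel_def)
next
  fix a b assume "a \<notin> hat_vertices G D \<or> b \<notin> hat_vertices G D"
  then show "hat_T G D (emb k) a b = 0"
    by (cases a; cases b) (auto simp: hat_T_def kron_def mat_one_def perm_mat_def hat_vertices_def)
qed

definition label :: "('v \<Rightarrow> 'v \<Rightarrow> complex) \<Rightarrow> 'v rel" where
  "label g = local_rel (the_inv_into (carrier \<Gamma>) emb g)"

lemma label_emb [simp]: "m \<in> carrier \<Gamma> \<Longrightarrow> label (emb m) = local_rel m"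
  using emb_bij by (simp add: label_def bij_betw_def the_inv_into_f_f)

text \<open>The border carries ones for the unit label only, which matches the trivial row and
  column of \<open>b\<close> at \<open>p x\<close>. One formula thus covers border and
  interior.\<close>

lemma bordered_adj_label:
  assumes "m \<in> carrier \<Gamma>" "a \<in> H" "c \<in> H"
  shows "bordered_adj G D label (emb m) a c = (if a \<noteq> c \<and> m = b (idx a) (idx c) then 1 else 0)"
proof -
  have one: "emb m = \<one>\<^bsub>G\<^esub> \<longleftrightarrow> m = \<one>"
    using emb_eq_iff[OF assms(1) one_closed] emb_one by simp
  have I: "p x \<in> I" "y \<in> D \<Longrightarrow> p y \<in> I" for y
    using x D_in_V by auto
  show ?thesis
    using assms by (cases a; cases c) (auto simp: one idx_def I row column adj_def local_rel_def)
qed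

text \<open>For vertices in different fibres only the label \<open>b (p u) (p v)\<close> contributes
  to the sum, and its permutation matrix expresses
  \<open>q v = q u \<otimes> k \<otimes> b (p u) (p v)\<close>.\<close>

lemma adj_hat_S:
  assumes k: "k \<in> carrier \<Gamma>"
  shows "adj (map_prod hat_map hat_map ` S k) = hat_S G D label (emb k)"
proof (rule adj_map_prod_image[OF hat_map_bij cross_rel_subset])
  fix u v assume uv: "u \<in> V" "v \<in> V"
  let ?a = "the_inv_into H idx (p u)" and ?c = "the_inv_into H idx (p v)"
  have ne: "?a = ?c \<longleftrightarrow> p u = p v" using idx_inv[OF uv(1)] idx_inv[OF uv(2)] by metis
  have bc: "b (p u) (p v) \<in> carrier \<Gamma>" using uv b_closed by simp
  have "hat_S G D label (emb k) (hat_map u) (hat_map v)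
      = (\<Sum>l\<in>carrier G. bordered_adj G D label l ?a ?c * perm_mat G (emb k \<otimes>\<^bsub>G\<^esub> l) (emb (q u)) (emb (q v)))"
    by (simp add: hat_S_def sum_fun_apply kron_def hat_map_def)
  also have "\<dots> = (\<Sum>m\<in>carrier \<Gamma>. bordered_adj G D label (emb m) ?a ?c
                      * perm_mat G (emb k \<otimes>\<^bsub>G\<^esub> emb m) (emb (q u)) (emb (q v)))"
    by (rule sum.reindex_bij_betw[OF emb_bij, symmetric])
  \<comment> \<open>Within one fibre both sides vanish: the bordered matrices have zero diagonal,
    and \<open>S k\<close> relates no two vertices of a fibre.\<close>
  also have "\<dots> = (\<Sum>m\<in>carrier \<Gamma>. if m = b (p u) (p v) then adj (S k) u v else 0)"
  proof (rule sum.cong)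
    fix m assume m: "m \<in> carrier \<Gamma>"
    show "bordered_adj G D label (emb m) ?a ?c * perm_mat G (emb k \<otimes>\<^bsub>G\<^esub> emb m) (emb (q u)) (emb (q v))
        = (if m = b (p u) (p v) then adj (S k) u v else 0)"
      unfolding bordered_adj_label[OF m inv_idx_in[OF uv(1)] inv_idx_in[OF uv(2)]]
      using uv m k ne bc
      by (auto simp: idx_inv emb_mult perm_mat_emb adj_def cross_rel_def m_assoc)
  qed simp
  also have "\<dots> = adj (S k) u v" using bc finite_carrier by simp
  finally show "hat_S G D label (emb k) (hat_map u) (hat_map v) = adj (S k) u v" .
next
  fix a c :: "'v option \<times> ('v \<Rightarrow> 'v \<Rightarrow> complex)"
  assume out: "a \<notin> hat_vertices G D \<or> c \<notin> hat_vertices G D"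
  have sub: "label l \<subseteq> D \<times> D" for l by (auto simp: label_def local_rel_def)
  have zero: "bordered_adj G D label l y z = 0" if "y \<notin> H \<or> z \<notin> H" for l y z
    using that sub[of l] by (cases y; cases z) (auto simp: adj_def)
  obtain y g z h where ac: "a = (y, g)" "c = (z, h)" by fastforce
  have "bordered_adj G D label l y z * perm_mat G (emb k \<otimes>\<^bsub>G\<^esub> l) g h = 0" for l
    using out zero[of y z l] unfolding ac hat_vertices_def perm_mat_def by auto
  then show "hat_S G D label (emb k) a c = 0"
    by (simp add: ac hat_S_def sum_fun_apply kron_def del: mult_eq_0_iff)
qed

lemma hat_decomposition:
  assumes "D \<noteq> {}" "card (local_rels X D - {Id_on D}) = order G"
  shows "bij_betw label (carrier G) (local_rels X D - {Id_on D})"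
    and "\<forall>g\<in>carrier G. converse (label g) = label (inv\<^bsub>G\<^esub> g)"
    and "\<exists>Z. adj ` Z = {hat_T G D k | k. k \<in> carrier G} \<union> {hat_S G D label k | k. k \<in> carrier G} \<and>
          scheme_iso V X (hat_vertices G D) Z"
proof -
  have ord: "order G = order \<Gamma>"
    using emb_bij by (simp add: order_def bij_betw_same_card)
  have carr: "carrier G = emb ` carrier \<Gamma>" using emb_bij by (simp add: bij_betw_def)
  show "bij_betw label (carrier G) (local_rels X D - {Id_on D})"
    using bij_betw_trans[OF bij_betw_the_inv_into[OF emb_bij] bij_local_rel] assms
    by (simp add: ord label_def[abs_def] comp_def)
  show "\<forall>g\<in>carrier G. converse (label g) = label (inv\<^bsub>G\<^esub> g)"
    by (simp add: carr emb_inv converse_local_rel)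
  let ?Z = "(\<lambda>R. map_prod hat_map hat_map ` R) ` X"
  have "adj ` ?Z = hat_T G D ` carrier G \<union> hat_S G D label ` carrier G"
  proof -
    have "adj ` ?Z = (\<lambda>k. adj (map_prod hat_map hat_map ` T k)) ` carrier \<Gamma>
        \<union> (\<lambda>k. adj (map_prod hat_map hat_map ` S k)) ` carrier \<Gamma>"
      by (subst rels) (simp only: image_Un image_image)
    also have "\<dots> = hat_T G D ` emb ` carrier \<Gamma> \<union> hat_S G D label ` emb ` carrier \<Gamma>"
      by (simp add: image_image adj_hat_T adj_hat_S cong: image_cong_simp)
    finally show ?thesis by (simp only: carr)
  qed
  moreover have "scheme_iso V X (hat_vertices G D) ?Z"
    unfolding scheme_iso_def
    by (intro conjI exI[of _ hat_map] scheme assoc_scheme_bij_image[OF scheme hat_map_bij]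
        hat_map_bij refl)
  ultimately show "\<exists>Z. adj ` Z = {hat_T G D k | k. k \<in> carrier G} \<union> {hat_S G D label k | k. k \<in> carrier G} \<and>
          scheme_iso V X (hat_vertices G D) Z"
    by (intro exI[of _ ?Z]) (simp add: Setcompr_eq_image)
qed

end

theorem theorem5p3:
  fixes \<Gamma> :: "('g, 'm) monoid_scheme"
    and \<Omega> :: "'v set" and X :: "'v rel set" and S :: "'v rel" and x :: 'v
    and G :: "('v \<Rightarrow> 'v \<Rightarrow> complex) monoid" and D :: "'v set" and Y :: "'v rel set"
  assumes roux: "roux_scheme \<Gamma> \<Omega> X"
    and G: "G = thin_radical \<Omega> X"
    and x: "x \<in> \<Omega>"
    and S: "S \<in> X" "\<not> thin \<Omega> S"
    and D: "D = S `` {x}"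
    and Y: "Y = local_rels X D"
    and local_scheme: "assoc_scheme D Y"
    and classes: "card (Y - {Id_on D}) = order G"
  shows "\<exists>R. bij_betw R (carrier G) (Y - {Id_on D}) \<and>
             (\<forall>g\<in>carrier G. converse (R g) = R (inv\<^bsub>G\<^esub> g)) \<and>
             (\<exists>Z. adj ` Z = {hat_T G D k | k. k \<in> carrier G}
                            \<union> {hat_S G D R k | k. k \<in> carrier G} \<and>
                  scheme_iso \<Omega> X (hat_vertices G D) Z)"
proof -
  obtain I :: "nat set" and p q b where "roux_coordinates \<Gamma> \<Omega> X I p q b"
    using roux_scheme_coordinates[OF roux] .
  then interpret R0: roux_coordinates \<Gamma> \<Omega> X I p q b .
  \<comment> \<open>Normalization at the fibre of \<open>x\<close> provides the trivial row required
    by \<open>roux_neighbourhood\<close>.\<close>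
  define q' where "q' u = q u \<otimes>\<^bsub>\<Gamma>\<^esub> b (p u) (p x)" for u
  define b' where "b' i j = b (p x) i \<otimes>\<^bsub>\<Gamma>\<^esub> b i j \<otimes>\<^bsub>\<Gamma>\<^esub> b j (p x)" for i j
  have px: "p x \<in> I" using x by simp
  interpret R1: roux_coordinates \<Gamma> \<Omega> X I p q' b'
    using R0.normalize[OF px] unfolding q'_def[abs_def] b'_def[abs_def] .
  have row: "b' (p x) i = \<one>\<^bsub>\<Gamma>\<^esub>" if "i \<in> I" for i
    using that px R0.b_closed R0.b_diag R0.b_swap[of "p x" i] by (simp add: b'_def)
  \<comment> \<open>Fibre relations are thin, so the thick relation \<open>S\<close> must be a cross
    relation.\<close>
  obtain k where k: "k \<in> carrier \<Gamma>" "S = cross_rel \<Gamma> \<Omega> p q' b' k"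
    using S R1.rels R1.thin_fibre_rel by auto
  interpret N: roux_neighbourhood \<Gamma> \<Omega> X I p q' b' x k D
    by unfold_locales (use x row k D S in auto)
  have "D \<noteq> {}" using local_scheme by (simp add: assoc_scheme_def)
  note hat = N.hat_decomposition[OF this classes[unfolded G Y]]
  show ?thesis
    unfolding G Y by (intro exI[of _ N.label] conjI hat)
qed

end
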